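(* Assume the Axiom of Choice. Let $U\subseteq\mathbb{R}$ be $\tau_{\mathbb{Q}}$-open. (1) There exists a bilaterally $\mathbb{Q}$-continuous function $h:\mathbb{R}\to[0,\infty)$ such that $h^{-1}((0,\infty))=U$. (2) More generally, if $D\subsetneq\mathbb{R}$ is a nonempty open set in the usual topology, then there exists a bilaterally $\mathbb{Q}$-continuous function $g:\mathbb{R}\to\mathbb{R}$ such that $g^{-1}(D)=U$.
   Context: The Axiom of Choice is assumed in addition to ZF. The topology $\tau_{\mathbb{Q}}$ on $\mathbb{R}$: a set $U\subseteq\mathbb{R}$ is $\tau_{\mathbb{Q}}$-open iff for every $a\in U$ and every real $x\neq0$ there is $\varepsilon(a,x)>0$ such that $a+qx\in U$ for all $q\in\mathbb{Q}$ with $0<q<\varepsilon(a,x)$. For real $y\neq z$ put $S(y,z)=\{qy+(1-q)z: q\in\mathbb{Q}\cap[0,1]\}$. A function $f:\mathbb{R}\to\mathbb{R}$ is bilaterally $\mathbb{Q}$-continuous if for every $x\in\mathbb{R}$ there is $\epsilon>0$ such that for all $y,z$ with $x-\epsilon\le y<z\le x+\epsilon$ there is a continuous (in the usual sense) function $f_{y,z}:[y,z]\to\mathbb{R}$ with $f_{y,z}(t)=f(t)$ for all $t\in S(y,z)$. *)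

theory Defs
  imports "HOL-Analysis.Analysis"
begin

definition tauQ_open :: "real set \<Rightarrow> bool" where
  "tauQ_open U \<longleftrightarrow>
     (\<forall>a\<in>U. \<forall>x. x \<noteq> 0 \<longrightarrow> (\<exists>\<epsilon>>0. \<forall>q\<in>\<rat>. 0 < q \<and> q < \<epsilon> \<longrightarrow> a + q * x \<in> U))"

definition tauQ :: "real topology" where
  "tauQ = topology tauQ_open"

lemma istopology_tauQ_open: "istopology tauQ_open"
  unfolding istopology_def
proof (intro conjI allI impI)
  fix S T :: "real set"
  assume S: "tauQ_open S" and T: "tauQ_open T"
  show "tauQ_open (S \<inter> T)"
    unfolding tauQ_open_def
  proof (intro ballI allI impI)
    fix a x :: real
    assume a: "a \<in> S \<inter> T" and x: "x \<noteq> 0"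
    obtain d where d: "d > 0" "\<forall>q\<in>\<rat>. 0 < q \<and> q < d \<longrightarrow> a + q * x \<in> S"
      using S a x unfolding tauQ_open_def by blast
    obtain e where e: "e > 0" "\<forall>q\<in>\<rat>. 0 < q \<and> q < e \<longrightarrow> a + q * x \<in> T"
      using T a x unfolding tauQ_open_def by blast
    show "\<exists>\<epsilon>>0. \<forall>q\<in>\<rat>. 0 < q \<and> q < \<epsilon> \<longrightarrow> a + q * x \<in> S \<inter> T"
      using d e by (intro exI[of _ "min d e"]) auto
  qed
next
  fix K :: "real set set"
  assume "\<forall>S\<in>K. tauQ_open S"
  then show "tauQ_open (\<Union>K)"
    unfolding tauQ_open_def by (meson UnionE UnionI)
qed

lemma openin_tauQ: "openin tauQ U \<longleftrightarrow> tauQ_open U"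
  by (simp add: tauQ_def istopology_tauQ_open)

definition rational_segment :: "real \<Rightarrow> real \<Rightarrow> real set" where
  "rational_segment y z = {q * y + (1 - q) * z | q. q \<in> \<rat> \<and> 0 \<le> q \<and> q \<le> 1}"

definition bilaterally_Q_continuous :: "(real \<Rightarrow> real) \<Rightarrow> bool" where
  "bilaterally_Q_continuous f \<longleftrightarrow>
     (\<forall>x. \<exists>\<epsilon>>0. \<forall>y z. x - \<epsilon> \<le> y \<and> y < z \<and> z \<le> x + \<epsilon> \<longrightarrow>
        (\<exists>F :: real \<Rightarrow> real. continuous_on {y..z} F \<and> (\<forall>t\<in>rational_segment y z. F t = f t)))"

end

theory Submission
  imports Defs
begin

text \<open>
  View the reals as a vector space over the rationals. A set \<open>U\<close> is open in the topology
  exactly when it meets every rational line \<open>{y + q (z - y) | q rational}\<close> in a relatively open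
  set, and a function is bilaterally \<open>\<rat>\<close>-continuous as soon as its restriction to each rational
  line extends to a continuous function on the reals. On a single rational line \<open>M\<close> a function
  that is positive exactly on \<open>U\<close> is easy to find: the distance to the closure of \<open>M - U\<close>, or a positive constant
  if this set is empty. Multiplying
  it by a positive continuous function adjusts its values at finitely many points to any values that
  are positive on \<open>U\<close> and zero elsewhere (lemma \<open>modify_on_line\<close>). The problem is to treat all
  lines at once, since every point lies on uncountably many of them.

  The idea is to process the lines in a well-founded order such that, when a line is reached, only
  finitely many of its points already carry a value. The Axiom of Choice provides a Hamel basis. The
  support of a point is the finite set of basis elements that occur in it, and the support of a line
  is the union of the supports of its points. Two distinct points of a line determine the line, hence
  its support. Therefore a line of support \<open>F\<close> has at most one point of support \<open>G\<close> for each proper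
  subset \<open>G\<close> of \<open>F\<close>, and so only finitely many points of smaller support. Moreover the span of a
  finite \<open>F\<close> over the rationals is countable, so the lines of support \<open>F\<close> can be numbered by natural
  numbers, and each of them meets the finitely many lines with smaller numbers in at most one point
  each. Ordering lines lexicographically, first by the support under proper inclusion and then by the
  number, gives the required order. Well-founded choice along it
  (lemma \<open>paste_along_wellfounded_lines\<close>) yields \<open>h\<close>.

  For an open set \<open>D\<close> that is neither empty nor everything, let \<open>d\<close> be the first point outside \<open>D\<close>
  on the way from a point of \<open>D\<close> to a point of its complement. A continuous \<open>\<psi>\<close> that starts at \<open>d\<close> and
  backs into \<open>D\<close> satisfies \<open>\<psi> t \<in> D \<longleftrightarrow> t > 0\<close> for \<open>t \<ge> 0\<close>, so \<open>\<psi> \<circ> h\<close> has the property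
  required of \<open>g\<close>.
\<close>

section \<open>Rational lines\<close>

definition rational_line :: "real \<Rightarrow> real \<Rightarrow> real set" where
  "rational_line y z = {y + q * (z - y) | q. q \<in> \<rat>}"

definition rational_lines :: "real set set" where
  "rational_lines = {rational_line y z | y z. y \<noteq> z}"

definition positive_exactly_on :: "real set \<Rightarrow> (real \<Rightarrow> real) \<Rightarrow> bool" where
  "positive_exactly_on U h \<longleftrightarrow> (\<forall>p. 0 \<le> h p \<and> (0 < h p \<longleftrightarrow> p \<in> U))"

text \<open>
  The extension is sought on all of the reals, because a rational line is dense in them. This is
  a stronger demand than extension from each rational segment separately.
\<close>

definition continuously_extendable_from :: "real set \<Rightarrow> (real \<Rightarrow> real) \<Rightarrow> bool" where
  "continuously_extendable_from M h \<longleftrightarrow> (\<exists>G. continuous_on UNIV G \<and> (\<forall>p\<in>M. G p = h p))"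

lemma rational_line_subset_through_two_points:
  assumes "p \<in> rational_line y z" "p' \<in> rational_line y z" "p \<noteq> p'"
  shows "rational_line p p' \<subseteq> rational_line y z"
    and "rational_line y z \<subseteq> rational_line p p'"
proof -
  obtain s t where s: "s \<in> \<rat>" "p = y + s * (z - y)" and t: "t \<in> \<rat>" "p' = y + t * (z - y)"
    using assms unfolding rational_line_def by blast
  have st: "t - s \<noteq> 0" using s t assms(3) by auto
  have diff: "p' - p = (t - s) * (z - y)" unfolding s t by (simp add: algebra_simps)
  show "rational_line p p' \<subseteq> rational_line y z"
  proof
    fix x assume "x \<in> rational_line p p'"
    then obtain q where q: "q \<in> \<rat>" "x = p + q * (p' - p)" unfolding rational_line_def by blast
    have "x = p + q * ((t - s) * (z - y))" using q(2) diff by simp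
    also have "\<dots> = y + (s + q * (t - s)) * (z - y)" unfolding s by (simp only: ring_distribs ac_simps)
    finally have "x = y + (s + q * (t - s)) * (z - y)" .
    moreover have "s + q * (t - s) \<in> \<rat>" using q s t by (intro Rats_add Rats_mult Rats_diff)
    ultimately show "x \<in> rational_line y z" unfolding rational_line_def by blast
  qed
  show "rational_line y z \<subseteq> rational_line p p'"
  proof
    fix x assume "x \<in> rational_line y z"
    then obtain q where q: "q \<in> \<rat>" "x = y + q * (z - y)" unfolding rational_line_def by blast
    have "(q - s) / (t - s) * (p' - p) = (q - s) * (z - y)" unfolding diff using st by simp
    also have "\<dots> = x - p" unfolding q s by (simp add: left_diff_distrib)
    finally have "x = p + (q - s) / (t - s) * (p' - p)" by simp
    moreover have "(q - s) / (t - s) \<in> \<rat>" using q s t by (intro Rats_divide Rats_diff)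
    ultimately show "x \<in> rational_line p p'" unfolding rational_line_def by blast
  qed
qed

lemma rational_lines_eq_through_two_points:
  assumes "M \<in> rational_lines" "p \<in> M" "p' \<in> M" "p \<noteq> p'"
  shows "M = rational_line p p'"
proof -
  obtain y z where "M = rational_line y z" using assms(1) unfolding rational_lines_def by blast
  then show ?thesis
    using rational_line_subset_through_two_points[of p y z p'] assms(2-4) by (simp add: subset_antisym)
qed

lemma finite_if_no_two_distinct:
  assumes "\<And>x y. x \<in> S \<Longrightarrow> y \<in> S \<Longrightarrow> x = y"
  shows "finite S"
proof (cases "S = {}")
  case False
  then obtain x where "x \<in> S" by blast
  then have "S \<subseteq> {x}" using assms by blast
  then show ?thesis using finite_subset by blast
qed simp

lemma rational_lines_finite_Int:
  assumes "M \<in> rational_lines" "N \<in> rational_lines" "M \<noteq> N"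
  shows "finite (M \<inter> N)"
proof (rule finite_if_no_two_distinct, rule ccontr)
  fix p p' assume "p \<in> M \<inter> N" "p' \<in> M \<inter> N" "p \<noteq> p'"
  then have "M = rational_line p p'" "N = rational_line p p'"
    using rational_lines_eq_through_two_points[of _ p p'] assms(1,2) by blast+
  then show False using assms(3) by simp
qed

section \<open>Prescribing finitely many values on one line\<close>

text \<open>
  Openness in the two opposite directions along \<open>M\<close> makes \<open>M \<inter> U\<close> a relatively open subset of \<open>M\<close>
  in the usual topology. Hence the Euclidean closure of \<open>M - U\<close> can serve as the zero set
  of a continuous function that is positive on \<open>M \<inter> U\<close>.
\<close>

lemma tauQ_open_disjoint_closure_on_line:
  assumes U: "tauQ_open U" and M: "M \<in> rational_lines" and u: "u \<in> M" "u \<in> U"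
  shows "u \<notin> closure (M - U)"
proof -
  obtain y z where M_eq: "M = rational_line y z" and "y \<noteq> z"
    using M unfolding rational_lines_def by blast
  define x where "x = z - y"
  have x: "x \<noteq> 0" using \<open>y \<noteq> z\<close> by (simp add: x_def)
  obtain d where d: "d > 0" "\<forall>q\<in>\<rat>. 0 < q \<and> q < d \<longrightarrow> u + q * x \<in> U"
    using U u(2) x unfolding tauQ_open_def by blast
  have "- x \<noteq> 0" using x by simp
  then obtain e where e: "e > 0" "\<forall>q\<in>\<rat>. 0 < q \<and> q < e \<longrightarrow> u + q * - x \<in> U"
    using U u(2) unfolding tauQ_open_def by blast
  define r where "r = min d e * \<bar>x\<bar>"
  have r: "r > 0" using d(1) e(1) x by (simp add: r_def)
  have "v \<in> U" if v: "v \<in> M" "dist v u < r" for v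
  proof -
    obtain s t where s: "s \<in> \<rat>" "u = y + s * x" and t: "t \<in> \<rat>" "v = y + t * x"
      using u(1) v(1) unfolding M_eq rational_line_def x_def by blast
    have uv: "v = u + (t - s) * x" unfolding s t by (simp add: algebra_simps)
    then have "\<bar>t - s\<bar> * \<bar>x\<bar> < min d e * \<bar>x\<bar>"
      using v(2) by (simp add: dist_real_def abs_mult r_def)
    then have less: "\<bar>t - s\<bar> < min d e" by (rule mult_right_less_imp_less[OF _ abs_ge_zero])
    have rat: "t - s \<in> \<rat>" "s - t \<in> \<rat>" using s t by auto
    consider "t - s > 0" | "t - s = 0" | "s - t > 0" by linarith
    then show "v \<in> U"
    proof cases
      case 1 then show ?thesis using d(2) rat less uv by auto
    next
      case 2 then show ?thesis using uv u(2) by simp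
    next
      case 3
      then have "u + (s - t) * - x \<in> U" using e(2) rat less by auto
      moreover have "u + (s - t) * - x = v" unfolding uv by (simp add: algebra_simps)
      ultimately show ?thesis by simp
    qed
  qed
  then show ?thesis using r unfolding closure_approachable by blast
qed

lemma continuous_function_with_zero_set:
  fixes C :: "real set"
  assumes "closed C"
  obtains k :: "real \<Rightarrow> real" where "continuous_on UNIV k" "\<And>t. 0 \<le> k t" "\<And>t. k t = 0 \<longleftrightarrow> t \<in> C"
proof (cases "C = {}")
  case True
  then show ?thesis using that[of "\<lambda>_. 1"] by auto
next
  case False
  show ?thesis
  proof (rule that)
    show "continuous_on UNIV (\<lambda>t. infdist t C)" by (intro continuous_on_infdist continuous_on_id)
    show "0 \<le> infdist t C" for t by (rule infdist_nonneg)
    show "infdist t C = 0 \<longleftrightarrow> t \<in> C" for t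
      using in_closed_iff_infdist_zero[OF assms False] by simp
  qed
qed

text \<open>
  Interpolating the logarithms by Tietze's theorem and exponentiating keeps the function positive
  everywhere.
\<close>

lemma positive_continuous_interpolation:
  fixes v :: "real \<Rightarrow> real"
  assumes "finite A" "\<And>a. a \<in> A \<Longrightarrow> 0 < v a"
  obtains w where "continuous_on UNIV w" "\<And>t. 0 < w t" "\<And>a. a \<in> A \<Longrightarrow> w a = v a"
proof -
  have "continuous_on A (\<lambda>a. ln (v a))" using assms(1) by (rule continuous_on_finite)
  moreover have "closedin (top_of_set UNIV) A" using assms(1) by (simp add: finite_imp_closed)
  ultimately obtain g where g: "continuous_on UNIV g" "\<And>a. a \<in> A \<Longrightarrow> g a = ln (v a)"
    by (metis Tietze_unbounded)
  show ?thesis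
    using that[of "\<lambda>t. exp (g t)"] g assms(2) by (auto intro!: continuous_on_exp)
qed

text \<open>
  This is the step that handles one line. The continuous function is the product \<open>G = k w\<close>, where
  \<open>k\<close> vanishes exactly on the closure of \<open>M - U\<close> and \<open>w > 0\<close> corrects the values at the finitely many
  points of \<open>A \<inter> M \<inter> U\<close>. At the other points of \<open>A \<inter> M\<close> both \<open>G\<close> and \<open>h0\<close> are zero.
\<close>

lemma modify_on_line:
  assumes U: "tauQ_open U" and M: "M \<in> rational_lines"
    and A: "finite A" and h0: "positive_exactly_on U h0"
  shows "\<exists>h. positive_exactly_on U h \<and> continuously_extendable_from M h \<and> (\<forall>p\<in>A. h p = h0 p)"
proof -
  define C where "C = closure (M - U)"
  have C: "p \<in> C \<longleftrightarrow> p \<notin> U" if "p \<in> M" for p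
  proof
    show "p \<notin> U" if "p \<in> C"
      using tauQ_open_disjoint_closure_on_line[OF U M \<open>p \<in> M\<close>] that unfolding C_def by blast
    show "p \<in> C" if "p \<notin> U"
      using closure_subset[of "M - U"] \<open>p \<in> M\<close> that unfolding C_def by blast
  qed
  obtain k :: "real \<Rightarrow> real" where k: "continuous_on UNIV k" "\<And>t. 0 \<le> k t" "\<And>t. k t = 0 \<longleftrightarrow> t \<in> C"
    by (rule continuous_function_with_zero_set[of C]) (auto simp: C_def)
  have k_pos: "0 < k p \<longleftrightarrow> p \<in> U" if "p \<in> M" for p
    using C[OF that] k(2)[of p] k(3)[of p] by (metis less_eq_real_def less_irrefl)
  have h0_pos: "0 < h0 p \<longleftrightarrow> p \<in> U" and h0_nonneg: "0 \<le> h0 p" for p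
    using h0 unfolding positive_exactly_on_def by auto
  obtain w where w: "continuous_on UNIV w" "\<And>t. 0 < w t"
      "\<And>p. p \<in> A \<inter> M \<inter> U \<Longrightarrow> w p = h0 p / k p"
    by (rule positive_continuous_interpolation[of "A \<inter> M \<inter> U" "\<lambda>p. h0 p / k p"])
      (use A h0_pos k_pos in auto)
  define G where "G t = k t * w t" for t
  define h where "h p = (if p \<in> M then G p else h0 p)" for p
  have "positive_exactly_on U h"
    unfolding positive_exactly_on_def h_def G_def
    using h0_pos h0_nonneg k_pos k(2) w(2)
    by (simp add: zero_less_mult_iff less_imp_le not_less[THEN iffD2])
  moreover have "continuously_extendable_from M h"
    unfolding continuously_extendable_from_def
    by (rule exI[of _ G]) (auto simp: h_def G_def intro!: continuous_on_mult k w)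
  moreover have "h p = h0 p" if p: "p \<in> A" for p
  proof (cases "p \<in> M")
    case True
    show ?thesis
    proof (cases "p \<in> U")
      case in_U: True
      then have "k p \<noteq> 0" using k_pos[OF True] by simp
      then show ?thesis using w(3)[of p] p True in_U by (simp add: h_def G_def)
    next
      case False
      then have "k p = 0" "h0 p = 0" using k(3) C[OF True] h0_pos[of p] h0_nonneg[of p] by auto
      then show ?thesis by (simp add: h_def G_def)
    qed
  qed (simp add: h_def)
  ultimately show ?thesis by blast
qed

section \<open>Pasting along a well-founded family of lines\<close>

text \<open>
  The map \<open>b\<close> tells at which stage the value of a point is settled. Stage \<open>i\<close> chooses a function
  on the reals that extends continuously from \<open>L i\<close> and repeats the values of those points of \<open>L i\<close>
  that were settled before. The pasted function takes at \<open>p\<close> the value chosen at stage \<open>b p\<close>, so it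
  agrees with the function of stage \<open>i\<close> on all of \<open>L i\<close>.
\<close>

lemma paste_along_wellfounded_lines:
  fixes L :: "'i \<Rightarrow> real set" and b :: "real \<Rightarrow> 'i"
  assumes U: "tauQ_open U" and wf: "wf r"
    and lines: "\<And>i. L i \<in> rational_lines \<or> L i = {}"
    and born: "\<And>i p. p \<in> L i \<Longrightarrow> b p = i \<or> (b p, i) \<in> r"
    and fin: "\<And>i. finite {p \<in> L i. (b p, i) \<in> r}"
  shows "\<exists>h. positive_exactly_on U h \<and> (\<forall>i. continuously_extendable_from (L i) h)"
proof -
  define P where "P f i h \<longleftrightarrow> positive_exactly_on U h \<and> continuously_extendable_from (L i) h
      \<and> (\<forall>p\<in>L i. (b p, i) \<in> r \<longrightarrow> h p = f (b p) p)" for f :: "'i \<Rightarrow> real \<Rightarrow> real" and i h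
  have "\<exists>f. \<forall>i. P f i (f i)"
  proof (rule dependent_wf_choice[OF wf])
    show "P f i h = P g i h" if "\<And>j. (j, i) \<in> r \<Longrightarrow> f j = g j" for f g i h
      unfolding P_def using that by auto
  next
    fix i f assume IH: "\<And>j. (j, i) \<in> r \<Longrightarrow> P f j (f j)"
    \<comment> \<open>The values settled before stage \<open>i\<close>. Off them only positivity exactly on \<open>U\<close> matters.\<close>
    define h0 where "h0 p = (if (b p, i) \<in> r then f (b p) p else indicator U p)" for p
    have h0: "positive_exactly_on U h0"
      using IH unfolding positive_exactly_on_def P_def h0_def by (auto simp: indicator_def)
    show "\<exists>h. P f i h"
    proof (cases "L i = {}")
      case True
      then have "continuously_extendable_from (L i) h0"
        unfolding continuously_extendable_from_def by (auto intro: exI[of _ "\<lambda>_. 0"])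
      then show ?thesis using h0 True unfolding P_def by auto
    next
      case False
      then obtain h where "positive_exactly_on U h" "continuously_extendable_from (L i) h"
          "\<forall>p\<in>{p \<in> L i. (b p, i) \<in> r}. h p = h0 p"
        using modify_on_line[OF U _ fin h0] lines by blast
      then show ?thesis unfolding P_def h0_def by auto
    qed
  qed
  then obtain f where f: "\<And>i. P f i (f i)" by blast
  define h where "h p = f (b p) p" for p
  have "positive_exactly_on U h"
    using f unfolding P_def positive_exactly_on_def h_def by blast
  moreover have "continuously_extendable_from (L i) h" for i
  proof -
    have "f i p = h p" if "p \<in> L i" for p
      using born[OF that] f[of i] that unfolding P_def h_def by auto
    then show ?thesis using f[of i] unfolding P_def continuously_extendable_from_def by auto
  qed
  ultimately show ?thesis by blast
qed

section \<open>Supports with respect to a Hamel basis\<close>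

text \<open>
  The support of \<open>p\<close> is the set of elements of a Hamel basis with nonzero coordinate at \<open>p\<close>. A point
  with support in a finite \<open>F\<close> is determined by a function from \<open>F\<close> to the rationals, which is why
  there are only countably many such points. The three properties are all that the ordering
  of the lines requires.
\<close>

lemma finite_rational_supports_exist:
  obtains supp :: "real \<Rightarrow> real set" where
    "\<And>p. finite (supp p)"
    "\<And>p y z. p \<in> rational_line y z \<Longrightarrow> supp p \<subseteq> supp y \<union> supp z"
    "\<And>F. finite F \<Longrightarrow> countable {p. supp p \<subseteq> F}"
proof -
  interpret Q: vector_space "\<lambda>(q::rat) (x::real). of_rat q * x"
    by unfold_locales (auto simp: algebra_simps of_rat_add of_rat_mult)
  define B where "B = Q.extend_basis {}"
  have ind: "Q.independent B" and span: "p \<in> Q.span B" for p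
    unfolding B_def using Q.independent_extend_basis[OF Q.independent_empty]
      Q.span_extend_basis[OF Q.independent_empty] by auto
  define coord where "coord = Q.representation B"
  define supp where "supp p = {e. coord p e \<noteq> 0}" for p
  have fin: "finite (supp p)" for p
    unfolding supp_def coord_def by (rule Q.finite_representation)
  have sub: "supp p \<subseteq> supp y \<union> supp z" if "p \<in> rational_line y z" for p y z
  proof -
    obtain q :: rat where "p = y + of_rat q * (z - y)"
      using \<open>p \<in> rational_line y z\<close> unfolding rational_line_def Rats_def by blast
    then have "coord p e = coord y e + q * (coord z e - coord y e)" for e
      unfolding coord_def
      by (simp add: Q.representation_add[OF ind] Q.representation_scale[OF ind]
          Q.representation_diff[OF ind] span)
    then show ?thesis unfolding supp_def by auto
  qed
  have cnt: "countable {p. supp p \<subseteq> F}" if F: "finite F" for F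
  proof -
    have "inj_on (\<lambda>p. restrict (coord p) F) {p. supp p \<subseteq> F}"
    proof (rule inj_onI)
      fix p p' assume p: "p \<in> {p. supp p \<subseteq> F}" "p' \<in> {p. supp p \<subseteq> F}"
        and eq: "restrict (coord p) F = restrict (coord p') F"
      have "coord p e = coord p' e" for e
      proof (cases "e \<in> F")
        case True then show ?thesis using fun_cong[OF eq, of e] by simp
      next
        case False then show ?thesis using p unfolding supp_def by (metis (mono_tags, lifting) mem_Collect_eq subsetD)
      qed
      then have "coord p = coord p'" by blast
      then show "p = p'"
        unfolding coord_def using Q.sum_nonzero_representation_eq[OF ind span] by metis
    qed
    moreover have "countable ((\<lambda>p. restrict (coord p) F) ` {p. supp p \<subseteq> F})"
    proof (rule countable_subset)
      show "countable (F \<rightarrow>\<^sub>E (UNIV :: rat set))" by (intro countable_PiE F) auto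
    qed auto
    ultimately show ?thesis by (metis countable_image_inj_on)
  qed
  show ?thesis using that[of supp] fin sub cnt by blast
qed

section \<open>A function continuous along all rational lines\<close>

text \<open>
  Lines are indexed by pairs of a support and a number. A point \<open>p\<close> is settled on the line of least
  number among those through \<open>p\<close> whose support equals that of \<open>p\<close>. A line of support \<open>F\<close> through
  \<open>p\<close> has either \<open>F = supp p\<close> and a number that is at least this one, or a strictly larger support;
  in both cases it does not precede the stage at which \<open>p\<close> is settled. A point that lies on no line of
  its own support, such as 0, is settled at an arbitrary stage with that support.
\<close>

lemma exists_positive_exactly_on_line_continuous:
  assumes U: "tauQ_open U"
  shows "\<exists>h. positive_exactly_on U h \<and> (\<forall>M\<in>rational_lines. continuously_extendable_from M h)"
proof -
  obtain supp :: "real \<Rightarrow> real set" where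
    supp_fin: "\<And>p. finite (supp p)" and
    supp_line: "\<And>p y z. p \<in> rational_line y z \<Longrightarrow> supp p \<subseteq> supp y \<union> supp z" and
    supp_countable: "\<And>F. finite F \<Longrightarrow> countable {p. supp p \<subseteq> F}"
    using finite_rational_supports_exist by metis
  define lsupp where "lsupp M = (\<Union>p\<in>M. supp p)" for M
  have lsupp_eq: "lsupp M = supp p \<union> supp p'"
    if "M \<in> rational_lines" "p \<in> M" "p' \<in> M" "p \<noteq> p'" for M p p'
    using rational_lines_eq_through_two_points[OF that] supp_line that(2,3)
    unfolding lsupp_def by blast
  have two_points: "\<exists>p p'. p \<in> M \<and> p' \<in> M \<and> p \<noteq> p' \<and> M = rational_line p p'"
    if M: "M \<in> rational_lines" for M
  proof -
    obtain y z where yz: "M = rational_line y z" "y \<noteq> z" using M unfolding rational_lines_def by blast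
    have "y = y + 0 * (z - y)" "z = y + 1 * (z - y)" by auto
    then have "y \<in> M" "z \<in> M" unfolding yz rational_line_def using Rats_0 Rats_1 by blast+
    then show ?thesis using yz by blast
  qed
  have lsupp_fin: "finite (lsupp M)" if "M \<in> rational_lines" for M
    using two_points[OF that] lsupp_eq[OF that] supp_fin by (metis finite_UnI)
  define lines_over where "lines_over F = {M \<in> rational_lines. lsupp M = F}" for F
  have lines_countable: "countable (lines_over F)" for F
  proof (cases "finite F")
    case True
    define W where "W = {p. supp p \<subseteq> F}"
    have "lines_over F \<subseteq> case_prod rational_line ` (W \<times> W)"
    proof
      fix M assume M: "M \<in> lines_over F"
      then obtain p p' where "p \<in> M" "p' \<in> M" "M = rational_line p p'"
        using two_points unfolding lines_over_def by blast
      moreover from this have "p \<in> W" "p' \<in> W"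
        using M unfolding lines_over_def W_def lsupp_def by blast+
      ultimately show "M \<in> case_prod rational_line ` (W \<times> W)" by auto
    qed
    moreover have "countable W" unfolding W_def using True by (rule supp_countable)
    then have "countable (case_prod rational_line ` (W \<times> W))" by simp
    ultimately show ?thesis by (rule countable_subset)
  next
    case False
    then have "lines_over F = {}" using lsupp_fin unfolding lines_over_def by blast
    then show ?thesis by simp
  qed
  define number where "number M = to_nat_on (lines_over (lsupp M)) M" for M
  have number_inj: "M = N"
    if "M \<in> rational_lines" "N \<in> rational_lines" "lsupp M = lsupp N" "number M = number N" for M N
    by (rule inj_onD[OF inj_on_to_nat_on[OF lines_countable[of "lsupp N"]]])
      (use that in \<open>simp_all add: number_def lines_over_def\<close>)
  \<comment> \<open>The union has at most one member and makes \<open>L\<close> total: unused pairs get the empty set.\<close>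
  define L where "L = (\<lambda>(F, n). \<Union>{M \<in> rational_lines. lsupp M = F \<and> number M = n})"
  have L_line: "L (lsupp M, number M) = M" if "M \<in> rational_lines" for M
  proof -
    have "{N \<in> rational_lines. lsupp N = lsupp M \<and> number N = number M} = {M}"
      using that number_inj by blast
    then show ?thesis unfolding L_def by simp
  qed
  have L_cases: "(\<exists>M. M \<in> rational_lines \<and> lsupp M = F \<and> number M = n \<and> L (F, n) = M) \<or> L (F, n) = {}" for F n
  proof (cases "\<exists>M. M \<in> rational_lines \<and> lsupp M = F \<and> number M = n")
    case True then show ?thesis using L_line by blast
  next
    case False then show ?thesis unfolding L_def by auto
  qed
  define r :: "((real set \<times> nat) \<times> (real set \<times> nat)) set"
    where "r = finite_psubset <*lex*> less_than"
  define b where "b p = (supp p, LEAST n. p \<in> L (supp p, n))" for p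
  have "\<exists>h. positive_exactly_on U h \<and> (\<forall>i. continuously_extendable_from (L i) h)"
  proof (rule paste_along_wellfounded_lines[OF U, where r = r and b = b])
    show "wf r" unfolding r_def by (intro wf_lex_prod wf_finite_psubset wf_less_than)
    show "L i \<in> rational_lines \<or> L i = {}" for i :: "real set \<times> nat"
      using L_cases by (cases i) blast
  next
    fix i :: "real set \<times> nat" and p assume p: "p \<in> L i"
    obtain F n where i: "i = (F, n)" by (cases i)
    obtain M where M: "M \<in> rational_lines" "lsupp M = F" "L i = M"
      using L_cases[of F n] p i by auto
    have sub: "supp p \<subseteq> F" and fin: "finite F"
      using p M lsupp_fin unfolding lsupp_def by auto
    show "b p = i \<or> (b p, i) \<in> r"
    proof (cases "supp p = F")
      case True
      then have "(LEAST n. p \<in> L (supp p, n)) \<le> n" using p i by (auto intro: Least_le)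
      then show ?thesis using True unfolding b_def r_def i by auto
    next
      case False
      then show ?thesis using sub fin unfolding b_def r_def i by (auto simp: finite_psubset_def)
    qed
  next
    fix i :: "real set \<times> nat"
    obtain F n where i: "i = (F, n)" by (cases i)
    show "finite {p \<in> L i. (b p, i) \<in> r}"
    proof (cases "L i = {}")
      case False
      then obtain M where M: "M \<in> rational_lines" "lsupp M = F" "number M = n" "L i = M"
        using L_cases[of F n] i by auto
      \<comment> \<open>A point of \<open>M\<close> settled earlier has smaller support or lies on a line of smaller number.\<close>
      have "{p \<in> L i. (b p, i) \<in> r} \<subseteq> {p \<in> M. supp p \<subset> F} \<union> (\<Union>m<n. M \<inter> L (F, m))"
      proof
        fix p assume p: "p \<in> {p \<in> L i. (b p, i) \<in> r}"
        show "p \<in> {p \<in> M. supp p \<subset> F} \<union> (\<Union>m<n. M \<inter> L (F, m))"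
        proof (cases "supp p = F")
          case True
          then have "p \<in> L (F, n)" using p i by simp
          then have "p \<in> L (F, LEAST n. p \<in> L (F, n))" by (rule LeastI)
          moreover have "(LEAST n. p \<in> L (F, n)) < n"
            using p True unfolding b_def r_def i by (auto simp: finite_psubset_def)
          ultimately show ?thesis using p M(4) by blast
        next
          case False
          then show ?thesis using p M(4) unfolding b_def r_def i by (auto simp: finite_psubset_def)
        qed
      qed
      moreover have "finite {p \<in> M. supp p \<subset> F}"
      proof (rule inj_on_finite[where f = supp and B = "Pow F"])
        \<comment> \<open>Two points of \<open>M\<close> with the same support would give \<open>M\<close> that support too.\<close>
        show "inj_on supp {p \<in> M. supp p \<subset> F}"
          using lsupp_eq[OF M(1)] M(2) by (intro inj_onI) blast
        show "finite (Pow F)" using lsupp_fin[OF M(1)] M(2) by simp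
      qed auto
      moreover have "finite (M \<inter> L (F, m))" if "m < n" for m
      proof -
        consider N where "N \<in> rational_lines" "number N = m" "L (F, m) = N" | "L (F, m) = {}"
          using L_cases[of F m] by blast
        then show ?thesis
        proof cases
          case 1
          then have "M \<noteq> N" using M(3) that by auto
          then show ?thesis using rational_lines_finite_Int[OF M(1)] 1 by simp
        qed simp
      qed
      then have "finite (\<Union>m<n. M \<inter> L (F, m))" by blast
      ultimately show ?thesis using finite_subset finite_UnI by blast
    qed simp
  qed
  then show ?thesis using L_line by metis
qed

section \<open>From continuity along lines to the theorem\<close>

lemma bilaterally_Q_continuous_if_extendable:
  assumes "\<And>M. M \<in> rational_lines \<Longrightarrow> continuously_extendable_from M f"
  shows "bilaterally_Q_continuous f"
  unfolding bilaterally_Q_continuous_def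
proof (intro allI exI[of _ "1::real"] conjI impI)
  fix x y z :: real assume "x - 1 \<le> y \<and> y < z \<and> z \<le> x + 1"
  then have "rational_line y z \<in> rational_lines" unfolding rational_lines_def by blast
  then obtain G where G: "continuous_on UNIV G" "\<forall>p\<in>rational_line y z. G p = f p"
    using assms unfolding continuously_extendable_from_def by blast
  have "rational_segment y z \<subseteq> rational_line y z"
  proof
    fix t assume "t \<in> rational_segment y z"
    then obtain q where q: "q \<in> \<rat>" "t = q * y + (1 - q) * z" unfolding rational_segment_def by blast
    then have "t = y + (1 - q) * (z - y)" "1 - q \<in> \<rat>" by (auto simp: algebra_simps)
    then show "t \<in> rational_line y z" unfolding rational_line_def by blast
  qed
  then show "\<exists>F. continuous_on {y..z} F \<and> (\<forall>t\<in>rational_segment y z. F t = f t)"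
    using G continuous_on_subset[OF G(1), of "{y..z}"] by blast
qed simp

lemma continuously_extendable_compose:
  assumes "continuously_extendable_from M h" "continuous_on UNIV \<psi>"
  shows "continuously_extendable_from M (\<lambda>p. \<psi> (h p))"
proof -
  obtain G where "continuous_on UNIV G" "\<forall>p\<in>M. G p = h p"
    using assms(1) unfolding continuously_extendable_from_def by blast
  then show ?thesis
    unfolding continuously_extendable_from_def
    by (auto intro!: exI[of _ "\<lambda>p. \<psi> (G p)"] continuous_on_compose2[OF assms(2)])
qed

text \<open>
  Let \<open>s\<close> be the first parameter at which the segment from \<open>a \<in> D\<close> to \<open>c \<notin> D\<close> leaves \<open>D\<close>. The map \<open>\<psi>\<close>
  runs this segment backwards from the point at \<open>s\<close> and stops for good when it reaches \<open>a\<close>.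
\<close>

lemma continuous_map_entering_open_set:
  fixes D :: "real set"
  assumes D: "open D" "D \<noteq> {}" "D \<noteq> UNIV"
  obtains \<psi> :: "real \<Rightarrow> real" where
    "continuous_on UNIV \<psi>" "\<And>t. 0 \<le> t \<Longrightarrow> \<psi> t \<in> D \<longleftrightarrow> 0 < t"
proof -
  obtain a c where a: "a \<in> D" and c: "c \<notin> D" using D by blast
  define T where "T = {0..} \<inter> (\<lambda>t. a + t * (c - a)) -` (- D)"
  have "closed T"
    unfolding T_def using D(1)
    by (intro closed_Int closed_vimage closed_Compl) (auto intro!: continuous_intros)
  moreover have "1 \<in> T" using c by (simp add: T_def)
  moreover have bdd: "bdd_below T" unfolding T_def by (intro bdd_belowI[of _ 0]) auto
  ultimately have Inf_T: "Inf T \<in> T" using closed_contains_Inf by blast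
  define s where "s = Inf T"
  have s: "0 \<le> s" "a + s * (c - a) \<notin> D" using Inf_T unfolding T_def s_def by auto
  then have "s > 0" using a by (cases "s = 0") auto
  have before: "a + t * (c - a) \<in> D" if "0 \<le> t" "t < s" for t
    using that cInf_lower[OF _ bdd, of t] unfolding s_def T_def by fastforce
  define \<psi> where "\<psi> t = a + (s - min t s) * (c - a)" for t
  have "continuous_on UNIV \<psi>" unfolding \<psi>_def by (intro continuous_intros)
  moreover have "\<psi> t \<in> D \<longleftrightarrow> 0 < t" if "0 \<le> t" for t
    using s(2) before[of "s - min t s"] \<open>s > 0\<close> that unfolding \<psi>_def by (cases "t = 0") auto
  ultimately show ?thesis using that by blast
qed

theorem theorem9p12:
  fixes U :: "real set"
  assumes "openin tauQ U"
  shows "(\<exists>h :: real \<Rightarrow> real. bilaterally_Q_continuous h \<and> (\<forall>x. 0 \<le> h x) \<and> h -` {0<..} = U) \<and>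
         (\<forall>D :: real set. open D \<and> D \<noteq> {} \<and> D \<noteq> UNIV \<longrightarrow>
            (\<exists>g :: real \<Rightarrow> real. bilaterally_Q_continuous g \<and> g -` D = U))"
proof -
  have "tauQ_open U" using assms by (simp add: openin_tauQ)
  then obtain h where h: "positive_exactly_on U h"
      and ext: "\<forall>M\<in>rational_lines. continuously_extendable_from M h"
    using exists_positive_exactly_on_line_continuous by blast
  have h_nonneg: "0 \<le> h p" and h_pos: "0 < h p \<longleftrightarrow> p \<in> U" for p
    using h unfolding positive_exactly_on_def by auto
  show ?thesis
  proof (intro conjI allI impI)
    have "bilaterally_Q_continuous h"
      using ext by (simp add: bilaterally_Q_continuous_if_extendable)
    then show "\<exists>h. bilaterally_Q_continuous h \<and> (\<forall>x. 0 \<le> h x) \<and> h -` {0<..} = U"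
      using h_nonneg h_pos by (intro exI[of _ h]) auto
  next
    fix D :: "real set" assume "open D \<and> D \<noteq> {} \<and> D \<noteq> UNIV"
    then obtain \<psi> :: "real \<Rightarrow> real" where \<psi>: "continuous_on UNIV \<psi>" "\<And>t. 0 \<le> t \<Longrightarrow> \<psi> t \<in> D \<longleftrightarrow> 0 < t"
      using continuous_map_entering_open_set[of D] by blast
    have "bilaterally_Q_continuous (\<lambda>p. \<psi> (h p))"
      using ext \<psi>(1) by (simp add: bilaterally_Q_continuous_if_extendable continuously_extendable_compose)
    moreover have "(\<lambda>p. \<psi> (h p)) -` D = U" using \<psi>(2) h_nonneg h_pos by auto
    ultimately show "\<exists>g. bilaterally_Q_continuous g \<and> g -` D = U" by blast
  qed
qed

end
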